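(* Let $n\ge1$, $w\in\mathbb{R}^n_{>0}$, $c_0\in\mathbb{R}^n$, $r_0>0$, $B_0=\mathcal{B}(c_0,r_0w)$ and $k\ge0$. For any deterministic algorithm that makes $k$ adaptive sign-vector queries and then outputs a point $\widehat x$, one has $$\sup_{z\in B_0}\ \|\widehat x(f_z)-z\|_{\infty,w}\ \ge\ 2^{-k}r_0,\qquad f_z(x)=\tfrac12\|x-z\|_2^2 .$$ Hence halving (Cube-Sign$(1/2,w)$ started from $B_0$, with output $c_k$) is minimax optimal, including the constant, on the class of all $f\in\mathcal{U}(x^*,B_0)$ with $x^*\in B_0$: its worst-case weighted error after $k$ queries is at most $2^{-k}r_0$ on this class, and no deterministic algorithm with $k$ sign-vector queries has worst-case weighted error smaller than $2^{-k}r_0$.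
   Context: $\mathcal{B}(c,r)=\{x:|x_i-c_i|\le r_i\ \forall i\}$; $\|u\|_{\infty,w}=\max_i|u_i|/w_i$. A sign-vector query at a point $c$ returns $\operatorname{sign}\nabla f(c)\in\{-1,0,+1\}^n$ (all coordinates at once, no magnitudes). A deterministic algorithm with $k$ adaptive queries chooses each query point as a function of previous answers, and its output $\widehat x$ is a function of all $k$ answers; the weighted output error for a function with target $x^*$ is $\|\widehat x-x^*\|_{\infty,w}$ (the target of $f_z$ is $z$). Class $\mathcal{U}(x^*,B)$ (for $x^*\in B$): functions $f$ differentiable on a neighbourhood of $B$ with $\partial_if(x)(x_i-x_i^* )>0$ for every $x\in B$ and every $i$ with $x_i\ne x_i^*$. Cube-Sign$(1/2,w)$: $c_{j+1}=c_j-2^{-j-1}r_0\,w\odot s_j$ with $s_j\in\{-1,+1\}^n$, $s_{j,i}=\operatorname{sign}\partial_if(c_j)$ if $\partial_if(c_j)\neq0$, and arbitrary in $\{-1,+1\}$ otherwise. *)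

theory Defs
  imports "HOL-Analysis.Analysis"
begin

definition weighted_box :: "real ^ 'n \<Rightarrow> real ^ 'n \<Rightarrow> (real ^ 'n) set" where
  "weighted_box c r = {x. \<forall>i. \<bar>x $ i - c $ i\<bar> \<le> r $ i}"

definition weighted_norm :: "real ^ 'n \<Rightarrow> real ^ 'n \<Rightarrow> real" where
  "weighted_norm w u = Max (range (\<lambda>i. \<bar>u $ i\<bar> / w $ i))"

text \<open>Where f is not differentiable, the gradient is a fixed but unspecified vector.\<close>

definition gradient :: "(real ^ 'n \<Rightarrow> real) \<Rightarrow> real ^ 'n \<Rightarrow> real ^ 'n" where
  "gradient f x = (THE D. GDERIV f x :> D)"

definition sign_query :: "(real ^ 'n \<Rightarrow> real) \<Rightarrow> real ^ 'n \<Rightarrow> real ^ 'n" where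
  "sign_query f c = (\<chi> i. sgn (gradient f c $ i))"

text \<open>A deterministic algorithm: both maps receive the list of answers so far, oldest first.\<close>

record 'n sign_algorithm =
  query_point :: "(real ^ 'n) list \<Rightarrow> real ^ 'n"
  output_point :: "(real ^ 'n) list \<Rightarrow> real ^ 'n"

primrec answers :: "'n sign_algorithm \<Rightarrow> (real ^ 'n \<Rightarrow> real) \<Rightarrow> nat \<Rightarrow> (real ^ 'n) list" where
  "answers A f 0 = []"
| "answers A f (Suc j) = answers A f j @ [sign_query f (query_point A (answers A f j))]"

definition query_at :: "'n sign_algorithm \<Rightarrow> (real ^ 'n \<Rightarrow> real) \<Rightarrow> nat \<Rightarrow> real ^ 'n" where
  "query_at A f j = query_point A (answers A f j)"

definition result :: "nat \<Rightarrow> 'n sign_algorithm \<Rightarrow> (real ^ 'n \<Rightarrow> real) \<Rightarrow> real ^ 'n" where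
  "result k A f = output_point A (answers A f k)"

definition class_U :: "real ^ 'n \<Rightarrow> (real ^ 'n) set \<Rightarrow> (real ^ 'n \<Rightarrow> real) set" where
  "class_U xs B = {f. (\<exists>S. open S \<and> B \<subseteq> S \<and> f differentiable_on S) \<and>
     (\<forall>x\<in>B. \<forall>i. x $ i \<noteq> xs $ i \<longrightarrow> gradient f x $ i * (x $ i - xs $ i) > 0)}"

definition class_instances :: "(real ^ 'n) set \<Rightarrow> ((real ^ 'n \<Rightarrow> real) \<times> (real ^ 'n)) set" where
  "class_instances B = {(f, xs). xs \<in> B \<and> f \<in> class_U xs B}"

definition worst_case_error :: "real ^ 'n \<Rightarrow> (real ^ 'n) set \<Rightarrow> nat \<Rightarrow> 'n sign_algorithm \<Rightarrow> ereal" where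
  "worst_case_error w B k A =
     (SUP (f, xs)\<in>class_instances B. ereal (weighted_norm w (result k A f - xs)))"

definition quadratic_fun :: "real ^ 'n \<Rightarrow> real ^ 'n \<Rightarrow> real" where
  "quadratic_fun z x = 1/2 * (norm (x - z))\<^sup>2"

text \<open>
  The first k steps of a run of Cube-Sign(1/2, w) on f, started from the box with centre c0
  and half-widths r0 w. The tie-breaking signs are left free, so this is a relation, not a
  function. Multiplication of vectors is componentwise.
\<close>

definition cube_sign_run ::
    "real ^ 'n \<Rightarrow> real ^ 'n \<Rightarrow> real \<Rightarrow> (real ^ 'n \<Rightarrow> real) \<Rightarrow> nat \<Rightarrow> (nat \<Rightarrow> real ^ 'n) \<Rightarrow> bool" where
  "cube_sign_run w c0 r0 f k c \<longleftrightarrow> c 0 = c0 \<and>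
     (\<forall>j<k. \<exists>s. (\<forall>i. s $ i \<in> {-1, 1}) \<and>
        (\<forall>i. gradient f (c j) $ i \<noteq> 0 \<longrightarrow> s $ i = sgn (gradient f (c j) $ i)) \<and>
        c (Suc j) = c j - ((1/2) ^ Suc j * r0) *\<^sub>R (w * s))"

text \<open>
  A deterministic algorithm realises k steps of Cube-Sign if, on every f, its query points
  followed by its output form a run, i.e. it breaks ties as some function of the answers.
\<close>

definition implements_cube_sign ::
    "real ^ 'n \<Rightarrow> real ^ 'n \<Rightarrow> real \<Rightarrow> nat \<Rightarrow> 'n sign_algorithm \<Rightarrow> bool" where
  "implements_cube_sign w c0 r0 k A \<longleftrightarrow>
     (\<forall>f. cube_sign_run w c0 r0 f k (\<lambda>j. if j < k then query_at A f j else result k A f))"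

end

theory Submission
  imports Defs
begin

text \<open>
  A query to \<open>quadratic_fun z\<close> at \<open>p\<close> returns the signs of \<open>p - z\<close>, so it compares every coordinate
  of \<open>p\<close> with the same coordinate of the unknown \<open>z\<close>. An adversary that has confined \<open>z\<close> to an open box
  looks, in each coordinate separately, at which side of the centre the query lies, and answers as if
  \<open>z\<close> were in the half of the box on the other side. Every \<open>z\<close> in the smaller box gives this answer, the
  sign is never \<open>0\<close> because the boxes are open, and each coordinate loses only a factor \<open>2\<close>
  although all of them are answered at once. After \<open>k\<close> queries there remains an open box with
  half-widths \<open>(1/2) ^ k * r0 * w\<close> on which the output of the algorithm is constant
  (\<open>adversary_box\<close>); of two points of it near opposite corners, one is at least almost
  \<open>(1/2) ^ k * r0\<close> away from this output (\<open>far_point_in_open_box\<close>).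

  Conversely, on the class in question the sign of the \<open>i\<close>-th partial derivative at \<open>c\<close> tells on which side
  of \<open>c\<close> the \<open>i\<close>-th coordinate of the target lies. If \<open>c\<close> is within \<open>2 * h\<close> of the target in this
  coordinate, a step of length \<open>h\<close> towards it leaves an error of at most \<open>h\<close>, and an arbitrary
  step of length \<open>h\<close> does so if the coordinate is already exact (\<open>cube_sign_error\<close>). As the quadratics
  belong to the class, the two bounds meet.
\<close>

lemma weighted_norm_ge: "\<bar>u $ i\<bar> / w $ i \<le> weighted_norm w u"
  unfolding weighted_norm_def by (rule Max_ge) auto

lemma weighted_norm_le:
  assumes "\<And>i. 0 < w $ i" and "\<And>i. \<bar>u $ i\<bar> \<le> e * w $ i"
  shows "weighted_norm w u \<le> e"
  unfolding weighted_norm_def using assms by (auto simp: pos_divide_le_eq)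

lemma gradient_eqI:
  assumes "GDERIV f x :> D"
  shows "gradient f x = D"
  unfolding gradient_def
proof (rule the_equality[where P = "\<lambda>D. GDERIV f x :> D", OF assms])
  fix D' assume "GDERIV f x :> D'"
  then have "(\<lambda>h. h \<bullet> D') = (\<lambda>h. h \<bullet> D)"
    using assms unfolding gderiv_def by (rule has_derivative_unique)
  then have "\<forall>h. h \<bullet> D' = h \<bullet> D" by meson
  then show "D' = D" by (simp only: vector_eq_ldot)
qed

lemma GDERIV_quadratic_fun: "GDERIV (quadratic_fun z) x :> x - z"
proof -
  have "((\<lambda>x. 1/2 * ((x - z) \<bullet> (x - z))) has_derivative (\<lambda>h. h \<bullet> (x - z))) (at x)"
    by (auto intro!: derivative_eq_intros simp: inner_commute)
  then show ?thesis
    unfolding gderiv_def quadratic_fun_def[abs_def] power2_norm_eq_inner .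
qed

lemma gradient_quadratic_fun [simp]: "gradient (quadratic_fun z) x = x - z"
  by (rule gradient_eqI) (rule GDERIV_quadratic_fun)

lemma sign_query_quadratic_fun: "sign_query (quadratic_fun z) p = (\<chi> i. sgn (p $ i - z $ i))"
  by (simp add: sign_query_def)

lemma quadratic_fun_in_class_U: "quadratic_fun z \<in> class_U z B"
proof -
  have "quadratic_fun z differentiable_on UNIV"
    using GDERIV_quadratic_fun[of z]
    unfolding gderiv_def differentiable_on_def differentiable_def by blast
  then show ?thesis
    unfolding class_U_def using open_UNIV by (auto simp: zero_less_mult_iff)
qed

text \<open>
  The adversary argument. The first conclusion keeps the box inside the initial one, so that its
  points are admissible targets; the second says that the first \<open>k\<close> queries cannot tell them apart.
\<close>

lemma adversary_box:
  fixes w c0 :: "real ^ 'n" and r0 :: real and A :: "'n sign_algorithm"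
  assumes w_pos: "\<And>i. 0 < w $ i" and r0_pos: "0 < r0"
  shows "\<exists>c L. (\<forall>z. (\<forall>i. \<bar>z $ i - c $ i\<bar> < (1/2) ^ k * r0 * w $ i) \<longrightarrow>
    z \<in> weighted_box c0 (r0 *\<^sub>R w) \<and> answers A (quadratic_fun z) k = L)"
proof (induction k)
  case 0
  show ?case
    by (rule exI[of _ c0]) (auto simp: weighted_box_def less_imp_le)
next
  case (Suc k)
  then obtain c L where IH: "\<And>z. (\<And>i. \<bar>z $ i - c $ i\<bar> < (1/2) ^ k * r0 * w $ i) \<Longrightarrow>
      z \<in> weighted_box c0 (r0 *\<^sub>R w) \<and> answers A (quadratic_fun z) k = L"
    by blast
  define p where "p = query_point A L"
  define h where "h i = (1/2) ^ Suc k * r0 * w $ i" for i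
  have h_pos: "h i > 0" for i
    using w_pos r0_pos by (simp add: h_def)
  have h_double: "(1/2) ^ k * r0 * w $ i = 2 * h i" for i
    by (simp add: h_def)
  define c' where "c' = (\<chi> i. if p $ i \<le> c $ i then c $ i + h i else c $ i - h i)"
  define s :: "real ^ 'n" where "s = (\<chi> i. if p $ i \<le> c $ i then -1 else 1)"
  have "z \<in> weighted_box c0 (r0 *\<^sub>R w) \<and> answers A (quadratic_fun z) (Suc k) = L @ [s]"
    if z: "\<And>i. \<bar>z $ i - c' $ i\<bar> < h i" for z
  proof -
    have "\<bar>z $ i - c $ i\<bar> < (1/2) ^ k * r0 * w $ i" for i
      using z[of i] h_pos[of i] unfolding h_double by (auto simp: c'_def split: if_splits)
    then have old: "z \<in> weighted_box c0 (r0 *\<^sub>R w)" "answers A (quadratic_fun z) k = L"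
      using IH by blast+
    have "sgn (p $ i - z $ i) = s $ i" for i
      using z[of i] by (auto simp: c'_def s_def sgn_if split: if_splits)
    then have "sign_query (quadratic_fun z) p = s"
      by (simp add: sign_query_quadratic_fun vec_eq_iff)
    then show ?thesis
      using old by (simp add: p_def)
  qed
  then show ?case unfolding h_def by blast
qed

text \<open>
  Two points that are nearly \<open>2 * e\<close> apart cannot both be much closer than \<open>e\<close> to \<open>x\<close>. Since the
  box is open, \<open>e\<close> itself need not be attained.
\<close>

lemma far_point_in_open_box:
  fixes w c x :: "real ^ 'n" and e y :: real
  assumes w_pos: "\<And>i. 0 < w $ i" and "0 < e" and "y < e"
  shows "\<exists>z. (\<forall>i. \<bar>z $ i - c $ i\<bar> < e * w $ i) \<and> y < weighted_norm w (x - z)"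
proof -
  obtain t where t: "max 0 y < t" "t < e"
    using dense[of "max 0 y" e] assms by auto
  (* any coordinate serves for comparing x with the centre *)
  fix i :: 'n
  define \<sigma> :: real where "\<sigma> = (if x $ i \<le> c $ i then 1 else -1)"
  define z where "z = c + (\<sigma> * t) *\<^sub>R w"
  have "\<bar>z $ j - c $ j\<bar> < e * w $ j" for j
    using t w_pos[of j] by (simp add: z_def \<sigma>_def abs_mult)
  moreover have "y < weighted_norm w (x - z)"
  proof -
    have "t * w $ i \<le> \<bar>(x - z) $ i\<bar>"
      using t w_pos[of i] by (auto simp: z_def \<sigma>_def)
    then have "t \<le> \<bar>(x - z) $ i\<bar> / w $ i"
      using w_pos[of i] by (simp add: pos_le_divide_eq)
    then show ?thesis
      using t weighted_norm_ge[of "x - z" i w] by linarith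
  qed
  ultimately show ?thesis by blast
qed

lemma quadratic_lower_bound:
  fixes w c0 :: "real ^ 'n" and r0 :: real and A :: "'n sign_algorithm"
  assumes w_pos: "\<And>i. 0 < w $ i" and r0_pos: "0 < r0"
  shows "ereal ((1/2) ^ k * r0) \<le>
    (SUP z\<in>weighted_box c0 (r0 *\<^sub>R w). ereal (weighted_norm w (result k A (quadratic_fun z) - z)))"
proof (rule ereal_le_real)
  fix y assume "(SUP z\<in>weighted_box c0 (r0 *\<^sub>R w).
    ereal (weighted_norm w (result k A (quadratic_fun z) - z))) \<le> ereal y"
  then have bound: "weighted_norm w (result k A (quadratic_fun z) - z) \<le> y"
    if "z \<in> weighted_box c0 (r0 *\<^sub>R w)" for z
    using that by (auto simp: SUP_le_iff)
  obtain c L where box: "\<And>z. (\<And>i. \<bar>z $ i - c $ i\<bar> < (1/2) ^ k * r0 * w $ i) \<Longrightarrow>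
      z \<in> weighted_box c0 (r0 *\<^sub>R w) \<and> answers A (quadratic_fun z) k = L"
    using adversary_box[OF w_pos r0_pos, of k c0 A] by blast
  show "ereal ((1/2) ^ k * r0) \<le> ereal y"
  proof (rule ccontr)
    assume "\<not> ?thesis"
    then have "y < (1/2) ^ k * r0" by simp
    then obtain z where z: "\<And>i. \<bar>z $ i - c $ i\<bar> < (1/2) ^ k * r0 * w $ i"
      and far: "y < weighted_norm w (output_point A L - z)"
      using far_point_in_open_box[OF w_pos, of "(1/2) ^ k * r0" y c "output_point A L"] r0_pos
      by auto
    from box[OF z] have "weighted_norm w (output_point A L - z) \<le> y"
      using bound[of z] by (simp add: result_def)
    with far show False by simp
  qed
qed

lemma worst_case_error_ge_quadratic:
  "(SUP z\<in>B. ereal (weighted_norm w (result k A (quadratic_fun z) - z))) \<le> worst_case_error w B k A"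
  unfolding worst_case_error_def
proof (rule SUP_least)
  fix z assume "z \<in> B"
  then have "(quadratic_fun z, z) \<in> class_instances B"
    by (simp add: class_instances_def quadratic_fun_in_class_U)
  from SUP_upper[OF this, of "\<lambda>(f, xs). ereal (weighted_norm w (result k A f - xs))"]
  show "ereal (weighted_norm w (result k A (quadratic_fun z) - z))
    \<le> (SUP (f, xs)\<in>class_instances B. ereal (weighted_norm w (result k A f - xs)))"
    by simp
qed

text \<open>
  The signs of the gradient are informative only inside the box, so the error bound is proved
  together with a bound on the distance from \<open>c0\<close>: the steps add up to less than \<open>r0 * w\<close>,
  and no iterate leaves the box.
\<close>

lemma cube_sign_error:
  fixes w c0 xs :: "real ^ 'n" and r0 :: real
  assumes w_pos: "\<And>i. 0 < w $ i" and r0_pos: "0 < r0"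
    and xs: "xs \<in> weighted_box c0 (r0 *\<^sub>R w)"
    and f: "f \<in> class_U xs (weighted_box c0 (r0 *\<^sub>R w))"
    and run: "cube_sign_run w c0 r0 f k c"
    and "j \<le> k"
  shows "\<bar>c j $ i - xs $ i\<bar> \<le> (1/2) ^ j * r0 * w $ i \<and>
    \<bar>c j $ i - c0 $ i\<bar> \<le> (1 - (1/2) ^ j) * (r0 * w $ i)"
  using \<open>j \<le> k\<close>
proof (induction j arbitrary: i)
  case 0
  then show ?case
    using run xs by (auto simp: cube_sign_run_def weighted_box_def abs_minus_commute)
next
  case (Suc j)
  then have IH: "\<bar>c j $ i - xs $ i\<bar> \<le> (1/2) ^ j * r0 * w $ i"
    "\<bar>c j $ i - c0 $ i\<bar> \<le> (1 - (1/2) ^ j) * (r0 * w $ i)" for i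
    by auto
  obtain s where s: "s $ i \<in> {-1, 1}"
    and s_grad: "gradient f (c j) $ i \<noteq> 0 \<longrightarrow> s $ i = sgn (gradient f (c j) $ i)"
    and step: "c (Suc j) = c j - ((1/2) ^ Suc j * r0) *\<^sub>R (w * s)"
    using run \<open>Suc j \<le> k\<close> unfolding cube_sign_run_def by (metis Suc_le_lessD)
  have "c j \<in> weighted_box c0 (r0 *\<^sub>R w)"
  proof -
    have "(1 - (1/2) ^ j) * (r0 * w $ i) \<le> r0 * w $ i" for i
      using w_pos[of i] r0_pos by (simp add: mult_left_le_one_le power_le_one)
    then show ?thesis
      using IH(2) unfolding weighted_box_def by (auto intro: order_trans)
  qed
  then have grad: "c j $ i \<noteq> xs $ i \<longrightarrow> gradient f (c j) $ i * (c j $ i - xs $ i) > 0"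
    using f unfolding class_U_def by blast
  define h where "h = (1/2) ^ Suc j * r0 * w $ i"
  have h_pos: "h > 0"
    using w_pos r0_pos by (simp add: h_def)
  have h_double: "(1/2) ^ j * r0 * w $ i = 2 * h"
    by (simp add: h_def)
  have step_i: "c (Suc j) $ i = c j $ i - h * s $ i"
    by (simp add: step h_def)
  have "c j $ i \<noteq> xs $ i \<longrightarrow> s $ i = sgn (c j $ i - xs $ i)"
    using grad s_grad by (auto simp: zero_less_mult_iff)
  then have "\<bar>c (Suc j) $ i - xs $ i\<bar> \<le> h"
    using s IH(1)[of i] h_pos unfolding step_i h_double
    by (auto simp: sgn_if split: if_splits)
  moreover have "\<bar>c (Suc j) $ i - c0 $ i\<bar> \<le> (1 - (1/2) ^ j) * (r0 * w $ i) + h"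
    using s IH(2)[of i] h_pos unfolding step_i by auto
  moreover have "(1 - (1/2) ^ j) * (r0 * w $ i) + h = (1 - (1/2) ^ Suc j) * (r0 * w $ i)"
    by (simp add: h_def field_simps)
  ultimately show ?case
    by (simp add: h_def)
qed

lemma cube_sign_upper_bound:
  fixes w c0 xs :: "real ^ 'n" and r0 :: real
  assumes w_pos: "\<And>i. 0 < w $ i" and r0_pos: "0 < r0"
    and "xs \<in> weighted_box c0 (r0 *\<^sub>R w)"
    and "f \<in> class_U xs (weighted_box c0 (r0 *\<^sub>R w))"
    and "cube_sign_run w c0 r0 f k c"
  shows "weighted_norm w (c k - xs) \<le> (1/2) ^ k * r0"
proof (rule weighted_norm_le[OF w_pos])
  show "\<bar>(c k - xs) $ i\<bar> \<le> (1/2) ^ k * r0 * w $ i" for i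
    using cube_sign_error[OF assms order_refl, of i] by simp
qed

definition break_ties :: "real ^ 'n \<Rightarrow> real ^ 'n" where
  "break_ties v = (\<chi> i. if v $ i = 0 then 1 else v $ i)"

definition cube_sign_iterate :: "real ^ 'n \<Rightarrow> real ^ 'n \<Rightarrow> real \<Rightarrow> (real ^ 'n) list \<Rightarrow> real ^ 'n" where
  "cube_sign_iterate w c0 r0 L =
     c0 - (\<Sum>j<length L. ((1/2) ^ Suc j * r0) *\<^sub>R (w * break_ties (L ! j)))"

text \<open>
  The answers determine the iterates, so one function of the answer list serves both for the
  queries and for the output.
\<close>

definition cube_sign_algorithm :: "real ^ 'n \<Rightarrow> real ^ 'n \<Rightarrow> real \<Rightarrow> 'n sign_algorithm" where
  "cube_sign_algorithm w c0 r0 =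
     \<lparr>query_point = cube_sign_iterate w c0 r0, output_point = cube_sign_iterate w c0 r0\<rparr>"

lemma length_answers [simp]: "length (answers A f j) = j"
  by (induction j) auto

lemma cube_sign_iterate_append:
  "cube_sign_iterate w c0 r0 (L @ [v]) =
     cube_sign_iterate w c0 r0 L - ((1/2) ^ Suc (length L) * r0) *\<^sub>R (w * break_ties v)"
  by (simp add: cube_sign_iterate_def nth_append)

lemma implements_cube_sign_algorithm: "implements_cube_sign w c0 r0 k (cube_sign_algorithm w c0 r0)"
  unfolding implements_cube_sign_def
proof
  fix f
  define A where "A = cube_sign_algorithm w c0 r0"
  define c where "c j = cube_sign_iterate w c0 r0 (answers A f j)" for j
  have query: "query_point A (answers A f j) = c j" for j
    by (simp add: c_def A_def cube_sign_algorithm_def)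
  have final: "output_point A (answers A f k) = c k"
    by (simp add: c_def A_def cube_sign_algorithm_def)
  have step: "c (Suc j) = c j - ((1/2) ^ Suc j * r0) *\<^sub>R (w * break_ties (sign_query f (c j)))" for j
    by (subst (1 2) c_def) (simp add: query cube_sign_iterate_append)
  have signs: "break_ties (sign_query f x) $ i \<in> {-1, 1}"
    "gradient f x $ i \<noteq> 0 \<longrightarrow> break_ties (sign_query f x) $ i = sgn (gradient f x $ i)" for x i
    by (auto simp: break_ties_def sign_query_def sgn_if)
  have "c 0 = c0"
    by (simp add: c_def cube_sign_iterate_def)
  then have "cube_sign_run w c0 r0 f k c"
    unfolding cube_sign_run_def using signs step by blast
  then have "cube_sign_run w c0 r0 f k (\<lambda>j. if j < k then query_at A f j else result k A f)"
    unfolding cube_sign_run_def query_at_def result_def query final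
    by (auto simp: less_Suc_eq dest: Suc_lessI)
  then show "cube_sign_run w c0 r0 f k (\<lambda>j. if j < k
      then query_at (cube_sign_algorithm w c0 r0) f j
      else result k (cube_sign_algorithm w c0 r0) f)"
    by (simp only: A_def)
qed

theorem theorem2p10:
  fixes w c0 :: "real ^ 'n" and r0 :: real and k :: nat and B0 :: "(real ^ 'n) set"
  assumes w_pos: "\<And>i. 0 < w $ i"
    and r0_pos: "0 < r0"
    and B0: "B0 = weighted_box c0 (r0 *\<^sub>R w)"
  shows
    "(\<forall>A :: 'n sign_algorithm.
        (SUP z\<in>B0. ereal (weighted_norm w (result k A (quadratic_fun z) - z)))
          \<ge> ereal ((1/2) ^ k * r0)) \<and>
     (\<forall>xs\<in>B0. \<forall>f\<in>class_U xs B0. \<forall>c. cube_sign_run w c0 r0 f k c \<longrightarrow>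
        weighted_norm w (c k - xs) \<le> (1/2) ^ k * r0) \<and>
     (\<forall>A :: 'n sign_algorithm. worst_case_error w B0 k A \<ge> ereal ((1/2) ^ k * r0)) \<and>
     (\<exists>A :: 'n sign_algorithm. implements_cube_sign w c0 r0 k A) \<and>
     (\<forall>A :: 'n sign_algorithm. implements_cube_sign w c0 r0 k A \<longrightarrow>
        worst_case_error w B0 k A = ereal ((1/2) ^ k * r0) \<and>
        (\<forall>A' :: 'n sign_algorithm. worst_case_error w B0 k A \<le> worst_case_error w B0 k A'))"
proof -
  have quadratic: "ereal ((1/2) ^ k * r0) \<le>
      (SUP z\<in>B0. ereal (weighted_norm w (result k A (quadratic_fun z) - z)))"
    for A :: "'n sign_algorithm"
    unfolding B0 by (rule quadratic_lower_bound[OF w_pos r0_pos])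
  have run: "weighted_norm w (c k - xs) \<le> (1/2) ^ k * r0"
    if "xs \<in> B0" "f \<in> class_U xs B0" "cube_sign_run w c0 r0 f k c" for xs f c
    using cube_sign_upper_bound[OF w_pos r0_pos] that unfolding B0 by blast
  have lower: "ereal ((1/2) ^ k * r0) \<le> worst_case_error w B0 k A" for A :: "'n sign_algorithm"
    using quadratic worst_case_error_ge_quadratic by (rule order_trans)
  have exact: "worst_case_error w B0 k A = ereal ((1/2) ^ k * r0)"
    if A: "implements_cube_sign w c0 r0 k A" for A :: "'n sign_algorithm"
  proof (rule antisym[OF _ lower])
    have "weighted_norm w (result k A f - xs) \<le> (1/2) ^ k * r0"
      if "(f, xs) \<in> class_instances B0" for f xs
      using run[of xs f "\<lambda>j. if j < k then query_at A f j else result k A f"] that A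
      by (simp add: class_instances_def implements_cube_sign_def)
    then show "worst_case_error w B0 k A \<le> ereal ((1/2) ^ k * r0)"
      unfolding worst_case_error_def by (auto intro!: SUP_least)
  qed
  show ?thesis
    using quadratic run lower exact implements_cube_sign_algorithm[of w c0 r0 k]
    by (intro conjI allI ballI impI exI[of _ "cube_sign_algorithm w c0 r0"]) simp_all
qed

end
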